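(* Let $\mathbb{F}$ be an arbitrary field, let $A\in\mathbb{F}^{n\times n}$ and let $\lambda_0$ be an eigenvalue of $A$ in, perhaps, an extension field $\widetilde{\mathbb{F}}$ of $\mathbb{F}$. Assume that the geometric multiplicity of $\lambda_0$ is $1$ and its algebraic multiplicity is $m$. Let $u_0,v_0\in\mathbb{F}^{n\times 1}$ be right and left eigenvectors of $A$ for $\lambda_0$. If $x,y\in\mathbb{F}^{n\times 1}$, then $\lambda_0$ is an eigenvalue of $A+xy^T$ if and only if $y^Tu_0=0$ or $v_0^Tx=0$.
   Context: A right eigenvector of $A$ for $\lambda_0$ is a nonzero vector $u$ with $Au=\lambda_0u$; a left eigenvector of $A$ for $\lambda_0$ is a nonzero vector $v$ with $v^TA=\lambda_0v^T$ (plain transpose, no conjugation). *)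

theory Defs
  imports "Jordan_Normal_Form.Char_Poly" "Jordan_Normal_Form.Matrix_Kernel"
begin

text \<open>The row vector \<open>v\<^sup>T\<close> is the \<open>1 \<times> n\<close> matrix \<open>mat_of_row v\<close>; no conjugation is involved.\<close>

definition left_eigenvector :: "'a :: comm_ring_1 mat \<Rightarrow> 'a vec \<Rightarrow> 'a \<Rightarrow> bool" where
  "left_eigenvector A v k \<longleftrightarrow>
     v \<in> carrier_vec (dim_row A) \<and> v \<noteq> 0\<^sub>v (dim_row A) \<and>
     mat_of_row v * A = k \<cdot>\<^sub>m mat_of_row v"

text \<open>\<open>char_matrix A k\<close> is \<open>A - k I\<close>, so its kernel is the eigenspace of \<open>A\<close> for \<open>k\<close>.\<close>

definition geometric_multiplicity :: "'a :: field mat \<Rightarrow> 'a \<Rightarrow> nat" where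
  "geometric_multiplicity A k = kernel_dim (char_matrix A k)"

definition algebraic_multiplicity :: "'a :: field mat \<Rightarrow> 'a \<Rightarrow> nat" where
  "algebraic_multiplicity A k = Polynomial.order k (char_poly A)"

text \<open>The rank-one matrix \<open>x y\<^sup>T\<close>, a column times a row.\<close>

definition outer_product :: "'a :: comm_ring_1 vec \<Rightarrow> 'a vec \<Rightarrow> 'a mat" where
  "outer_product x y = transpose_mat (mat_of_row x) * mat_of_row y"

end

theory Submission
  imports Defs
begin

text \<open>
  Write \<open>B\<close> for \<open>A\<close> over the extension field and \<open>x\<close>, \<open>y\<close> for the images of the two vectors; taking
  images commutes with forming \<open>A + x y\<^sup>T\<close>, so everything takes place over a single field.
  The perturbed matrix acts by \<open>(B + x y\<^sup>T) w = B w + (y\<^sup>T w) x\<close>, and its transpose is the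
  perturbation \<open>B\<^sup>T + y x\<^sup>T\<close> of \<open>B\<^sup>T\<close>.

  If \<open>y\<^sup>T u\<^sub>0 = 0\<close>, then \<open>u\<^sub>0\<close> is still an eigenvector. If \<open>v\<^sub>0\<^sup>T x = 0\<close>, the same remark applied
  to the transpose shows that \<open>v\<^sub>0\<close> is still a left eigenvector, and a matrix and its transpose have
  the same eigenvalues.

  Conversely, let \<open>w\<close> be an eigenvector of \<open>B + x y\<^sup>T\<close> for \<open>\<lambda>\<^sub>0\<close>. Multiplying
  \<open>B w + (y\<^sup>T w) x = \<lambda>\<^sub>0 w\<close> by \<open>v\<^sub>0\<^sup>T\<close> from the left cancels \<open>v\<^sub>0\<^sup>T B w\<close> against \<open>\<lambda>\<^sub>0 v\<^sub>0\<^sup>T w\<close> and leaves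
  \<open>(y\<^sup>T w) (v\<^sub>0\<^sup>T x) = 0\<close>. If \<open>v\<^sub>0\<^sup>T x \<noteq> 0\<close>, then \<open>y\<^sup>T w = 0\<close>, so \<open>w\<close> is an eigenvector of \<open>B\<close> itself.
  The eigenspace is a line, hence \<open>u\<^sub>0\<close> is a multiple of \<open>w\<close> and \<open>y\<^sup>T u\<^sub>0 = 0\<close> as well.
\<close>

lemma outer_product_carrier [simp, intro]:
  assumes "x \<in> carrier_vec n" and "y \<in> carrier_vec m"
  shows "outer_product x y \<in> carrier_mat n m"
  using assms by (auto simp: outer_product_def mat_of_row_def)

lemma outer_product_dim [simp]:
  "dim_row (outer_product x y) = dim_vec x" "dim_col (outer_product x y) = dim_vec y"
  by (simp_all add: outer_product_def mat_of_row_def)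

lemma outer_product_index [simp]:
  assumes "i < dim_vec x" and "j < dim_vec y"
  shows "outer_product x y $$ (i, j) = x $ i * y $ j"
  using assms by (simp add: outer_product_def scalar_prod_def mat_of_row_def)

lemma outer_product_mult_vec:
  assumes x: "x \<in> carrier_vec n" and y: "y \<in> carrier_vec m" and w: "w \<in> carrier_vec m"
  shows "outer_product x y *\<^sub>v w = (y \<bullet> w) \<cdot>\<^sub>v x"
proof (rule eq_vecI)
  show "dim_vec (outer_product x y *\<^sub>v w) = dim_vec ((y \<bullet> w) \<cdot>\<^sub>v x)"
    using x by simp
  fix i assume "i < dim_vec ((y \<bullet> w) \<cdot>\<^sub>v x)"
  then have i: "i < n" using x by simp
  show "(outer_product x y *\<^sub>v w) $ i = ((y \<bullet> w) \<cdot>\<^sub>v x) $ i"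
    using i x y w
    by (simp add: scalar_prod_def sum_distrib_right sum_distrib_left ac_simps)
qed

lemma transpose_outer_product:
  "transpose_mat (outer_product x y) = outer_product y x"
  by (intro eq_matI) (auto simp: mult.commute)

lemma (in comm_ring_hom) map_mat_add_outer_product:
  assumes A: "A \<in> carrier_mat n m" and x: "x \<in> carrier_vec n" and y: "y \<in> carrier_vec m"
  shows "map_mat hom (A + outer_product x y)
    = map_mat hom A + outer_product (map_vec hom x) (map_vec hom y)"
  using A x y
  by (intro eq_matI) (auto simp: hom_distribs)

lemma add_outer_product_mult_vec:
  assumes "A \<in> carrier_mat n m" and "x \<in> carrier_vec n" and "y \<in> carrier_vec m"
    and "w \<in> carrier_vec m"
  shows "(A + outer_product x y) *\<^sub>v w = A *\<^sub>v w + (y \<bullet> w) \<cdot>\<^sub>v x"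
  using assms by (simp add: add_mult_distrib_mat_vec[of _ n m] outer_product_mult_vec)

text \<open>
  Because left eigenvectors are eigenvectors of the transpose, statements about them follow from
  statements about right eigenvectors, with the roles of \<open>x\<close> and \<open>y\<close> exchanged in \<open>x y\<^sup>T\<close>.
\<close>

lemma left_eigenvector_iff_eigenvector_transpose:
  assumes A: "A \<in> carrier_mat n n"
  shows "left_eigenvector A v k \<longleftrightarrow> eigenvector (transpose_mat A) v k"
proof -
  have "mat_of_row v * A = k \<cdot>\<^sub>m mat_of_row v \<longleftrightarrow> transpose_mat A *\<^sub>v v = k \<cdot>\<^sub>v v"
    if v: "v \<in> carrier_vec n"
  proof -
    have "mat_of_row v * A = mat_of_row (transpose_mat A *\<^sub>v v)"
      using A v by (intro eq_matI) (auto intro!: comm_scalar_prod[of _ n])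
    moreover have "k \<cdot>\<^sub>m mat_of_row v = mat_of_row (k \<cdot>\<^sub>v v)"
      by (intro eq_matI) (auto simp: mat_of_row_def)
    ultimately show ?thesis by (metis row_mat_of_row)
  qed
  then show ?thesis using A unfolding left_eigenvector_def eigenvector_def by auto
qed

lemma eigenvalue_transpose_iff:
  fixes A :: "'a :: field mat"
  assumes "A \<in> carrier_mat n n"
  shows "eigenvalue (transpose_mat A) k \<longleftrightarrow> eigenvalue A k"
  using assms by (simp add: eigenvalue_root_char_poly[of _ n])

text \<open>
  This is how geometric multiplicity one enters: both vectors are multiples of the single element
  \<open>b\<close> of a basis of the kernel, and the factor belonging to \<open>w\<close> can be inverted.
\<close>

lemma kernel_dim_one_imp_multiple:
  fixes M :: "'a :: field mat"
  assumes M: "M \<in> carrier_mat nr nc" and dim: "kernel_dim M = 1"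
    and w: "w \<in> mat_kernel M" "w \<noteq> 0\<^sub>v nc" and u: "u \<in> mat_kernel M"
  obtains c where "u = c \<cdot>\<^sub>v w"
proof -
  interpret kernel nr nc M by (rule kernel.intro[OF M])
  obtain C where C: "finite C" "basis C" using kernel_basis_exists[OF M] by blast
  have "card C = 1" using dim Ker.dim_basis[OF C] kernel_dim by simp
  then obtain b where b: "C = {b}" by (auto simp: card_1_singleton_iff)
  have gen: "span {b} = mat_kernel M" and bK: "b \<in> mat_kernel M"
    using C(2) unfolding b Ker.basis_def by auto
  have bc: "b \<in> carrier_vec nc" using mat_kernelD[OF M bK] by simp
  have mult: "\<exists>c. z = c \<cdot>\<^sub>v b" if "z \<in> mat_kernel M" for z
  proof -
    have "z \<in> NC.span {b}" using that gen span_same[of "{b}"] bK by simp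
    then obtain a where z: "z = NC.lincomb a {b}"
      using NC.finite_span[of "{b}"] bc by auto
    have "z = a b \<cdot>\<^sub>v b"
      using bc NC.lincomb_index[of _ "{b}" a] NC.lincomb_dim[of "{b}" a]
      by (intro eq_vecI) (auto simp: z)
    then show ?thesis ..
  qed
  obtain c d where c: "w = c \<cdot>\<^sub>v b" and d: "u = d \<cdot>\<^sub>v b" using mult w(1) u by blast
  have "c \<noteq> 0" using c w(2) bc by auto
  then have "u = (d / c) \<cdot>\<^sub>v w" unfolding c d by (simp add: smult_smult_assoc)
  then show ?thesis by (rule that)
qed

lemma eigenvector_add_outer_product:
  assumes A: "A \<in> carrier_mat n n" and x: "x \<in> carrier_vec n" and y: "y \<in> carrier_vec n"
    and u: "eigenvector A u k" and yu: "y \<bullet> u = 0"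
  shows "eigenvector (A + outer_product x y) u k"
proof -
  have uc: "u \<in> carrier_vec n" using u A by (auto simp: eigenvector_def)
  have "(A + outer_product x y) *\<^sub>v u = A *\<^sub>v u"
    using add_outer_product_mult_vec[OF A x y uc] A x yu by auto
  then show ?thesis using u A outer_product_carrier[OF x y] by (auto simp: eigenvector_def)
qed

text \<open>
  The two alternatives are exchanged by transposition: if \<open>v\<^sup>T x = 0\<close>, then \<open>v\<close> is an eigenvector of
  the transposed perturbation, which has the same eigenvalues as the perturbation itself.
\<close>

lemma eigenvalue_add_outer_product_if:
  fixes A :: "'a :: field mat"
  assumes A: "A \<in> carrier_mat n n" and x: "x \<in> carrier_vec n" and y: "y \<in> carrier_vec n"
    and u: "eigenvector A u k" and v: "left_eigenvector A v k"
    and orth: "y \<bullet> u = 0 \<or> v \<bullet> x = 0"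
  shows "eigenvalue (A + outer_product x y) k"
  using orth
proof
  assume "y \<bullet> u = 0"
  then show ?thesis
    using eigenvector_add_outer_product[OF A x y u] unfolding eigenvalue_def by blast
next
  assume vx: "v \<bullet> x = 0"
  have v': "eigenvector (transpose_mat A) v k"
    using v left_eigenvector_iff_eigenvector_transpose[OF A] by simp
  then have "v \<in> carrier_vec n" using A by (auto simp: eigenvector_def)
  then have "x \<bullet> v = 0" using vx comm_scalar_prod[OF x] by simp
  then have "eigenvector (transpose_mat A + outer_product y x) v k"
    using eigenvector_add_outer_product[OF _ y x v'] A by simp
  moreover have "transpose_mat A + outer_product y x = transpose_mat (A + outer_product x y)"
    using transpose_add[OF A outer_product_carrier[OF x y]]
    by (simp add: transpose_outer_product)
  ultimately have "eigenvalue (transpose_mat (A + outer_product x y)) k"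
    unfolding eigenvalue_def by auto
  then show ?thesis using eigenvalue_transpose_iff[of "A + outer_product x y" n] A x y by simp
qed

text \<open>
  Pairing the eigenvector equation \<open>A w + (y\<^sup>T w) x = k w\<close> with \<open>v\<close> gives
  \<open>k v\<^sup>T w + (y\<^sup>T w) (v\<^sup>T x) = k v\<^sup>T w\<close>, since \<open>v\<^sup>T A = k v\<^sup>T\<close>; so the product \<open>(y\<^sup>T w) (v\<^sup>T x)\<close> vanishes.
\<close>

lemma eigenvector_add_outer_product_imp_orthogonal:
  fixes A :: "'a :: field mat"
  assumes A: "A \<in> carrier_mat n n" and x: "x \<in> carrier_vec n" and y: "y \<in> carrier_vec n"
    and w: "eigenvector (A + outer_product x y) w k" and v: "left_eigenvector A v k"
  shows "y \<bullet> w = 0 \<or> v \<bullet> x = 0"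
proof -
  have v': "eigenvector (transpose_mat A) v k"
    using v left_eigenvector_iff_eigenvector_transpose[OF A] by simp
  have vc: "v \<in> carrier_vec n" using v' A by (auto simp: eigenvector_def)
  have wc: "w \<in> carrier_vec n" using w outer_product_carrier[OF x y] by (auto simp: eigenvector_def)
  have "A *\<^sub>v w + (y \<bullet> w) \<cdot>\<^sub>v x = k \<cdot>\<^sub>v w"
    using w add_outer_product_mult_vec[OF A x y wc] by (simp add: eigenvector_def)
  then have "v \<bullet> (A *\<^sub>v w) + (y \<bullet> w) * (v \<bullet> x) = k * (v \<bullet> w)"
    using scalar_prod_add_distrib[of v n "A *\<^sub>v w" "(y \<bullet> w) \<cdot>\<^sub>v x"] A vc wc x by simp
  moreover have "v \<bullet> (A *\<^sub>v w) = k * (v \<bullet> w)"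
    using transpose_vec_mult_scalar[OF A wc vc] v' wc vc by (simp add: eigenvector_def)
  ultimately show ?thesis by simp
qed

text \<open>
  The previous lemma concerns an eigenvector \<open>w\<close> of the perturbed matrix. If \<open>v\<^sup>T x \<noteq> 0\<close>, it forces
  the perturbation to vanish on \<open>w\<close>, which therefore lies on the same line as \<open>u\<close>.
\<close>

lemma eigenvalue_add_outer_product_iff:
  fixes A :: "'a :: field mat"
  assumes A: "A \<in> carrier_mat n n" and x: "x \<in> carrier_vec n" and y: "y \<in> carrier_vec n"
    and geo: "geometric_multiplicity A k = 1"
    and u: "eigenvector A u k" and v: "left_eigenvector A v k"
  shows "eigenvalue (A + outer_product x y) k \<longleftrightarrow> y \<bullet> u = 0 \<or> v \<bullet> x = 0"
proof
  assume "eigenvalue (A + outer_product x y) k"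
  then obtain w where w: "eigenvector (A + outer_product x y) w k"
    unfolding eigenvalue_def by blast
  show "y \<bullet> u = 0 \<or> v \<bullet> x = 0"
  proof (rule disjCI)
    assume "v \<bullet> x \<noteq> 0"
    then have yw: "y \<bullet> w = 0"
      using eigenvector_add_outer_product_imp_orthogonal[OF A x y w v] by simp
    have wc: "w \<in> carrier_vec n" and w0: "w \<noteq> 0\<^sub>v n"
      using w outer_product_carrier[OF x y] by (auto simp: eigenvector_def)
    have "A *\<^sub>v w = (A + outer_product x y) *\<^sub>v w"
      using add_outer_product_mult_vec[OF A x y wc] A x yw by auto
    then have "eigenvector A w k" using w wc w0 A by (simp add: eigenvector_def)
    then have "w \<in> mat_kernel (char_matrix A k)" "u \<in> mat_kernel (char_matrix A k)"
      using u eigenvector_char_matrix[OF A] A by (auto intro!: mat_kernelI[of _ n n])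
    then obtain c where "u = c \<cdot>\<^sub>v w"
      using kernel_dim_one_imp_multiple[of "char_matrix A k" n n w u] A geo w0
      unfolding geometric_multiplicity_def by auto
    then show "y \<bullet> u = 0" using yw y wc by simp
  qed
next
  assume "y \<bullet> u = 0 \<or> v \<bullet> x = 0"
  then show "eigenvalue (A + outer_product x y) k"
    by (rule eigenvalue_add_outer_product_if[OF A x y u v])
qed

theorem proposition3p3:
  fixes emb :: "'f :: field \<Rightarrow> 'k :: field"
    and A :: "'f mat" and x y :: "'f vec"
    and lambda0 :: 'k and u0 v0 :: "'k vec"
    and n m :: nat
  assumes "field_hom emb"
    and "A \<in> carrier_mat n n"
    and "eigenvalue (map_mat emb A) lambda0"
    and "geometric_multiplicity (map_mat emb A) lambda0 = 1"
    and "algebraic_multiplicity (map_mat emb A) lambda0 = m"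
    and "eigenvector (map_mat emb A) u0 lambda0"
    and "left_eigenvector (map_mat emb A) v0 lambda0"
    and "x \<in> carrier_vec n"
    and "y \<in> carrier_vec n"
  shows "eigenvalue (map_mat emb (A + outer_product x y)) lambda0 \<longleftrightarrow>
         map_vec emb y \<bullet> u0 = 0 \<or> v0 \<bullet> map_vec emb x = 0"
proof -
  interpret field_hom emb by fact
  show ?thesis
    unfolding map_mat_add_outer_product[OF assms(2,8,9)]
    using assms by (intro eigenvalue_add_outer_product_iff[of _ n]) auto
qed

end
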